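(* Let $1\le m\le d$, let $C\in\mathbb{R}^{d\times d}$ be symmetric positive definite, and let $\lambda_1>\ldots>\lambda_m>\lambda_{m+1}\geq\ldots\geq\lambda_d>0$ be the eigenvalues of $C$. For $\eta>0$ define $H:\mathbb{R}^{d\times m}\to\mathbb{R}^{d\times m}$ by $$H(X)=X+\eta\Big(CX-X\,\mathcal{U}\big(X^TCX\big)\Big).$$ Suppose that $X^\star\in\mathbb{R}^{d\times m}$ satisfies $Cx_i^\star=\lambda_i x_i^\star$ for $i=1,\ldots,m$, where $x_i^\star$ denotes the $i$th column of $X^\star$, and $(X^\star)^TX^\star=I_m$. Then there exists $\eta^\star>0$ such that, for every $0<\eta<\eta^\star$, $$\rho\big(\mathbf{J}_H(X^\star)\big)<1.$$
   Context: For a square matrix $A$, $\mathcal{U}(A)$ denotes the upper triangular matrix of the same dimension as $A$ whose upper triangular part (including the diagonal) coincides with that of $A$ (entries strictly below the diagonal are set to zero). $\mathbf{J}_H(X)$ denotes the Jacobian of $H$ at $X$ (equivalently the differential of $H$ at $X$, a linear map $\mathbb{R}^{d\times m}\to\mathbb{R}^{d\times m}$, under the identification $\mathbb{R}^{d\times m}\cong\mathbb{R}^{dm}$). $\rho(\cdot)$ denotes the spectral radius (maximum modulus over all complex eigenvalues). $I_m$ is the $m\times m$ identity matrix. Eigenvalues of $C$ are listed with multiplicity. *)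

theory Defs
  imports "HOL-Analysis.Derivative" "Jordan_Normal_Form.Spectral_Radius"
begin

definition positive_definite_mat :: "real mat \<Rightarrow> bool" where
  "positive_definite_mat A \<longleftrightarrow> square_mat A \<and> A\<^sup>T = A \<and>
     (\<forall>x \<in> carrier_vec (dim_row A). x \<noteq> 0\<^sub>v (dim_row A) \<longrightarrow> scalar_prod x (A *\<^sub>v x) > 0)"

definition upper_part :: "real mat \<Rightarrow> real mat" where
  "upper_part A = mat (dim_row A) (dim_col A) (\<lambda>(i, j). if i \<le> j then A $$ (i, j) else 0)"

definition H_map :: "real mat \<Rightarrow> real \<Rightarrow> real mat \<Rightarrow> real mat" where
  "H_map C \<eta> X = X + \<eta> \<cdot>\<^sub>m (C * X - X * upper_part (X\<^sup>T * C * X))"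

definition mat_unit :: "nat \<Rightarrow> nat \<Rightarrow> nat \<Rightarrow> nat \<Rightarrow> real mat" where
  "mat_unit d m k l = mat d m (\<lambda>(i, j). if i = k \<and> j = l then 1 else 0)"

text \<open>The Jacobian matrix, i.e. the matrix of first-order partial derivatives, of a map \<open>F\<close> from
  real \<open>d \<times> m\<close> matrices to real \<open>d \<times> m\<close> matrices. The latter are identified with vectors of length
  \<open>d * m\<close> by stacking columns: position \<open>p\<close> of the vector is the entry \<open>(p mod d, p div d)\<close> of the
  matrix. The partial derivatives are meaningful only if they exist, as they do everywhere for
  maps with polynomial entries such as \<^const>\<open>H_map\<close>.\<close>

definition jacobian_mat :: "nat \<Rightarrow> nat \<Rightarrow> (real mat \<Rightarrow> real mat) \<Rightarrow> real mat \<Rightarrow> real mat" where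
  "jacobian_mat d m F X = mat (d * m) (d * m) (\<lambda>(p, q).
     deriv (\<lambda>t. F (X + t \<cdot>\<^sub>m mat_unit d m (q mod d) (q div d)) $$ (p mod d, p div d)) 0)"

end

theory Submission
  imports Defs "Jordan_Normal_Form.Schur_Decomposition"
begin

text \<open>
  Let \<open>\<Lambda>\<close> be the diagonal matrix of the leading \<open>m\<close> eigenvalues. At \<open>X\<close> one has \<open>CX = X\<Lambda>\<close> and
  \<open>X\<^sup>T C X = \<Lambda>\<close>, so the product rule turns the differential of \<open>H\<close> in the direction \<open>Z\<close> into
  \<open>Z + \<eta> (CZ - Z\<Lambda> - X U(Z\<^sup>T X \<Lambda> + \<Lambda> X\<^sup>T Z))\<close>, where \<open>U\<close> is the upper triangular part. Write
  \<open>a r j\<close> for the inner product of the columns \<open>x\<^sub>r\<close> of \<open>X\<close> and \<open>z\<^sub>j\<close> of \<open>Z\<close>. Taking inner products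
  with \<open>x\<^sub>r\<close>, and using that \<open>C\<close> is symmetric, shows that the differential multiplies

  \<^item> \<open>a r j\<close> with \<open>r > j\<close> by \<open>1 - \<eta> (\<lambda>\<^sub>j - \<lambda>\<^sub>r)\<close>;
  \<^item> \<open>a j j\<close> by \<open>1 - 2 \<eta> \<lambda>\<^sub>j\<close>;
  \<^item> \<open>a r j\<close> with \<open>r < j\<close> by \<open>1 - \<eta> \<lambda>\<^sub>j\<close>, up to a multiple of the entry \<open>a j r\<close> below the diagonal.

  This is a triangular system (\<open>proj_H_lin\<close>), so an eigenvector \<open>Z\<close> that is not orthogonal to all
  columns of \<open>X\<close> has one of these factors as its eigenvalue \<open>\<mu>\<close>. If \<open>Z\<close> is orthogonal to all columns
  of \<open>X\<close>, then the differential acts on each column as \<open>1 + \<eta> (C - \<lambda>\<^sub>j)\<close>, and a nonzero \<open>z\<^sub>j\<close>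
  is an eigenvector of \<open>C\<close>. Its eigenvalue \<open>\<lambda>\<^sub>r\<close> cannot be one of the leading ones: these are simple
  roots of the characteristic polynomial, so their eigenspaces are spanned by columns of \<open>X\<close>
  (\<open>simple_eigenvalue_eigenvectors_parallel\<close>). Hence \<open>r \<ge> m > j\<close> and \<open>\<mu> = 1 - \<eta> (\<lambda>\<^sub>j - \<lambda>\<^sub>r)\<close> again.

  In all cases \<open>\<mu> = 1 - \<eta> s\<close> with \<open>0 < s \<le> 2 \<lambda>\<^sub>0\<close>, \<open>\<lambda>\<^sub>0\<close> being the largest eigenvalue in the
  numbering from \<open>0\<close>. So every positive step size below \<open>1 / \<lambda>\<^sub>0\<close> gives spectral radius below \<open>1\<close>.
  That the matrix of partial derivatives represents this differential is \<open>jacobian_mult_vec\<close>; the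
  derivatives come from a product rule for matrix-valued functions of one real variable.
\<close>

unbundle no vec_syntax

section \<open>Simple eigenvalues have one-dimensional eigenspaces\<close>

text \<open>Back substitution: once the entries of \<open>y\<close> beyond \<open>i\<close> are known to vanish, row \<open>i\<close> of the
  eigenvector equation reads \<open>B\<^sub>i\<^sub>i y\<^sub>i = e y\<^sub>i\<close>.\<close>

lemma upper_triangular_eigenvector_index_0_only:
  fixes B :: "'a :: field mat"
  assumes B: "B \<in> carrier_mat n n" and ut: "upper_triangular B"
    and diag: "\<And>i. 0 < i \<Longrightarrow> i < n \<Longrightarrow> B $$ (i, i) \<noteq> e"
    and y: "y \<in> carrier_vec n" and ev: "B *\<^sub>v y = e \<cdot>\<^sub>v y"
    and i: "0 < i" "i < n"
  shows "y $ i = 0"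
  using i
proof (induction "n - i" arbitrary: i rule: less_induct)
  case less
  have "e * y $ i = (B *\<^sub>v y) $ i" using ev y less.prems by simp
  also have "\<dots> = (\<Sum>j\<in>{0..<n}. B $$ (i, j) * y $ j)"
    using B y less.prems by (simp add: scalar_prod_def)
  also have "\<dots> = B $$ (i, i) * y $ i + (\<Sum>j\<in>{0..<n} - {i}. B $$ (i, j) * y $ j)"
    using less.prems by (intro sum.remove) auto
  also have "(\<Sum>j\<in>{0..<n} - {i}. B $$ (i, j) * y $ j) = 0"
  proof (rule sum.neutral, intro ballI)
    fix j assume j: "j \<in> {0..<n} - {i}"
    show "B $$ (i, j) * y $ j = 0"
    proof (cases "j < i")
      case True
      then show ?thesis using ut B less.prems by (auto simp: upper_triangular_def)
    next
      case False
      then have "y $ j = 0" using j less.prems by (intro less.hyps) auto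
      then show ?thesis by simp
    qed
  qed
  finally have "(B $$ (i, i) - e) * y $ i = 0" by (auto simp: algebra_simps)
  then show ?case using diag[OF less.prems] by auto
qed

text \<open>A Schur decomposition may list the eigenvalues in any order. With the simple eigenvalue \<open>e\<close> in
  first position, back substitution forces every eigenvector of the triangular factor for \<open>e\<close> to be
  a multiple of the first unit vector.\<close>

lemma simple_eigenvalue_eigenvectors_parallel:
  fixes A :: "complex mat"
  assumes A: "A \<in> carrier_mat n n"
    and cp: "char_poly A = (\<Prod>a\<leftarrow>e # es. [:- a, 1:])" and simple: "e \<notin> set es"
    and v: "v \<in> carrier_vec n" "A *\<^sub>v v = e \<cdot>\<^sub>v v" "v \<noteq> 0\<^sub>v n"
    and w: "w \<in> carrier_vec n" "A *\<^sub>v w = e \<cdot>\<^sub>v w"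
  obtains c where "w = c \<cdot>\<^sub>v v"
proof -
  obtain B P Q where "schur_decomposition A (e # es) = (B, P, Q)"
    by (cases "schur_decomposition A (e # es)") auto
  from schur_decomposition[OF A cp this]
  have sim: "similar_mat_wit A B P Q" and ut: "upper_triangular B" and dB: "diag_mat B = e # es"
    by auto
  note PQ = similar_mat_witD2[OF A sim]
  have n: "n = Suc (length es)"
    using arg_cong[OF dB, of length] PQ(5) by (simp add: diag_mat_def)
  have diag: "B $$ (i, i) \<noteq> e" if "0 < i" "i < n" for i
  proof -
    have "B $$ (i, i) = diag_mat B ! i" using PQ(5) that by (simp add: diag_mat_def)
    also have "\<dots> = es ! (i - 1)" unfolding dB using that by (simp add: nth_Cons')
    finally show ?thesis using simple that n by auto
  qed
  have Qv: "Q *\<^sub>v u = (Q *\<^sub>v u) $ 0 \<cdot>\<^sub>v unit_vec n 0"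
    if u: "u \<in> carrier_vec n" "A *\<^sub>v u = e \<cdot>\<^sub>v u" for u
  proof -
    have Qu: "Q *\<^sub>v u \<in> carrier_vec n" using PQ(7) u(1) by auto
    have "B *\<^sub>v (Q *\<^sub>v u) = (Q * P) *\<^sub>v (B *\<^sub>v (Q *\<^sub>v u))"
      using PQ Qu by simp
    also have "\<dots> = Q *\<^sub>v (P *\<^sub>v (B *\<^sub>v (Q *\<^sub>v u)))"
      by (rule assoc_mult_mat_vec[of _ n n _ n]) (use PQ Qu in auto)
    also have "P *\<^sub>v (B *\<^sub>v (Q *\<^sub>v u)) = A *\<^sub>v u"
    proof -
      have "A *\<^sub>v u = (P * B) *\<^sub>v (Q *\<^sub>v u)"
        unfolding PQ(3) by (rule assoc_mult_mat_vec[of _ n n _ n]) (use PQ u in auto)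
      also have "\<dots> = P *\<^sub>v (B *\<^sub>v (Q *\<^sub>v u))"
        by (rule assoc_mult_mat_vec[of _ n n _ n]) (use PQ Qu in auto)
      finally show ?thesis by simp
    qed
    also have "Q *\<^sub>v (A *\<^sub>v u) = e \<cdot>\<^sub>v (Q *\<^sub>v u)"
      unfolding u(2) by (rule mult_mat_vec[OF PQ(7) u(1)])
    finally have ev: "B *\<^sub>v (Q *\<^sub>v u) = e \<cdot>\<^sub>v (Q *\<^sub>v u)" .
    show ?thesis
    proof (rule eq_vecI)
      fix i assume "i < dim_vec ((Q *\<^sub>v u) $ 0 \<cdot>\<^sub>v unit_vec n 0)"
      then have i: "i < n" by simp
      show "(Q *\<^sub>v u) $ i = ((Q *\<^sub>v u) $ 0 \<cdot>\<^sub>v unit_vec n 0) $ i"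
      proof (cases "i = 0")
        case False
        with upper_triangular_eigenvector_index_0_only[OF PQ(5) ut diag Qu ev _ i] i
        show ?thesis by (simp add: unit_vec_def)
      qed (use i in simp)
    qed (use PQ in auto)
  qed
  have recover: "u = P *\<^sub>v (Q *\<^sub>v u)" if "u \<in> carrier_vec n" for u
  proof -
    have "P *\<^sub>v (Q *\<^sub>v u) = (P * Q) *\<^sub>v u"
      by (rule assoc_mult_mat_vec[of _ n n _ n, symmetric]) (use PQ that in auto)
    then show ?thesis using PQ(1) that by simp
  qed
  let ?a = "(Q *\<^sub>v v) $ 0" and ?b = "(Q *\<^sub>v w) $ 0"
  have "?a \<noteq> 0"
  proof
    assume "?a = 0"
    then have "Q *\<^sub>v v = 0\<^sub>v n" using Qv[OF v(1,2)] by auto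
    then have "v = 0\<^sub>v n" using recover[OF v(1)] PQ(6) by auto
    with v(3) show False by simp
  qed
  then have "Q *\<^sub>v w = (?b / ?a) \<cdot>\<^sub>v (Q *\<^sub>v v)"
    by (subst Qv[OF w], subst (2) Qv[OF v(1,2)]) (auto simp: smult_smult_assoc)
  also have "\<dots> = Q *\<^sub>v ((?b / ?a) \<cdot>\<^sub>v v)"
    by (rule mult_mat_vec[OF PQ(7) v(1), symmetric])
  finally have "w = (?b / ?a) \<cdot>\<^sub>v v"
    using recover[OF w(1)] recover[of "(?b / ?a) \<cdot>\<^sub>v v"] v(1) by simp
  then show thesis by (rule that)
qed

section \<open>The derivative of the iteration map\<close>

text \<open>Matrices of variable dimension do not form a normed space, so derivatives are taken entrywise.
  The requirement that the dimensions stay constant in \<open>s\<close> is what makes the entries of sums and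
  products given by the same formula for all \<open>s\<close>.\<close>

definition has_mat_derivative :: "(real \<Rightarrow> real mat) \<Rightarrow> real mat \<Rightarrow> real \<Rightarrow> nat \<Rightarrow> nat \<Rightarrow> bool" where
  "has_mat_derivative F D t n k \<longleftrightarrow> (\<forall>s. F s \<in> carrier_mat n k) \<and> D \<in> carrier_mat n k \<and>
     (\<forall>i<n. \<forall>j<k. ((\<lambda>s. F s $$ (i, j)) has_field_derivative D $$ (i, j)) (at t))"

lemma has_mat_derivativeI:
  assumes "\<And>s. F s \<in> carrier_mat n k" and "D \<in> carrier_mat n k"
    and "\<And>i j. i < n \<Longrightarrow> j < k \<Longrightarrow>
      ((\<lambda>s. F s $$ (i, j)) has_field_derivative D $$ (i, j)) (at t)"
  shows "has_mat_derivative F D t n k"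
  using assms by (simp add: has_mat_derivative_def)

lemma has_mat_derivativeD:
  assumes "has_mat_derivative F D t n k"
  shows "F s \<in> carrier_mat n k" and "D \<in> carrier_mat n k"
    and "i < n \<Longrightarrow> j < k \<Longrightarrow> ((\<lambda>s. F s $$ (i, j)) has_field_derivative D $$ (i, j)) (at t)"
  using assms by (simp_all add: has_mat_derivative_def)

lemma has_mat_derivative_const:
  "A \<in> carrier_mat n k \<Longrightarrow> has_mat_derivative (\<lambda>s. A) (0\<^sub>m n k) t n k"
  by (rule has_mat_derivativeI) auto

lemma has_mat_derivative_line:
  assumes "X \<in> carrier_mat n k" and "Z \<in> carrier_mat n k"
  shows "has_mat_derivative (\<lambda>s. X + s \<cdot>\<^sub>m Z) Z t n k"
proof (rule has_mat_derivativeI)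
  fix i j assume "i < n" "j < k"
  then have "(\<lambda>s. (X + s \<cdot>\<^sub>m Z) $$ (i, j)) = (\<lambda>s. X $$ (i, j) + s * Z $$ (i, j))"
    using assms by auto
  then show "((\<lambda>s. (X + s \<cdot>\<^sub>m Z) $$ (i, j)) has_field_derivative Z $$ (i, j)) (at t)"
    by (auto intro!: derivative_eq_intros)
qed (use assms in auto)

lemma has_mat_derivative_add:
  assumes F: "has_mat_derivative F D t n k" and G: "has_mat_derivative G E t n k"
  shows "has_mat_derivative (\<lambda>s. F s + G s) (D + E) t n k"
proof (rule has_mat_derivativeI)
  fix i j assume ij: "i < n" "j < k"
  then have "(\<lambda>s. (F s + G s) $$ (i, j)) = (\<lambda>s. F s $$ (i, j) + G s $$ (i, j))"
    using has_mat_derivativeD(1)[OF G] by (metis carrier_matD index_add_mat(1))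
  then show "((\<lambda>s. (F s + G s) $$ (i, j)) has_field_derivative (D + E) $$ (i, j)) (at t)"
    using ij has_mat_derivativeD(2)[OF G]
    by (auto intro!: derivative_eq_intros has_mat_derivativeD(3)[OF F] has_mat_derivativeD(3)[OF G])
qed (use has_mat_derivativeD[OF F] has_mat_derivativeD[OF G] in auto)

lemma has_mat_derivative_minus:
  assumes F: "has_mat_derivative F D t n k" and G: "has_mat_derivative G E t n k"
  shows "has_mat_derivative (\<lambda>s. F s - G s) (D - E) t n k"
proof (rule has_mat_derivativeI)
  fix i j assume ij: "i < n" "j < k"
  then have "(\<lambda>s. (F s - G s) $$ (i, j)) = (\<lambda>s. F s $$ (i, j) - G s $$ (i, j))"
    using has_mat_derivativeD(1)[OF G] by (metis carrier_matD index_minus_mat(1))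
  then show "((\<lambda>s. (F s - G s) $$ (i, j)) has_field_derivative (D - E) $$ (i, j)) (at t)"
    using ij has_mat_derivativeD(2)[OF G]
    by (auto intro!: derivative_eq_intros has_mat_derivativeD(3)[OF F] has_mat_derivativeD(3)[OF G])
next
  show "F s - G s \<in> carrier_mat n k" for s
    using has_mat_derivativeD(1)[OF G] by (rule minus_carrier_mat)
  show "D - E \<in> carrier_mat n k"
    using has_mat_derivativeD(2)[OF G] by (rule minus_carrier_mat)
qed

lemma has_mat_derivative_smult:
  assumes F: "has_mat_derivative F D t n k"
  shows "has_mat_derivative (\<lambda>s. a \<cdot>\<^sub>m F s) (a \<cdot>\<^sub>m D) t n k"
proof (rule has_mat_derivativeI)
  fix i j assume ij: "i < n" "j < k"
  then have "(\<lambda>s. (a \<cdot>\<^sub>m F s) $$ (i, j)) = (\<lambda>s. a * F s $$ (i, j))"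
    using has_mat_derivativeD(1)[OF F] by (metis carrier_matD index_smult_mat(1))
  then show "((\<lambda>s. (a \<cdot>\<^sub>m F s) $$ (i, j)) has_field_derivative (a \<cdot>\<^sub>m D) $$ (i, j)) (at t)"
    using ij has_mat_derivativeD(2)[OF F]
    by (auto intro!: derivative_eq_intros has_mat_derivativeD(3)[OF F])
qed (use has_mat_derivativeD[OF F] in auto)

lemma has_mat_derivative_transpose:
  assumes F: "has_mat_derivative F D t n k"
  shows "has_mat_derivative (\<lambda>s. (F s)\<^sup>T) (D\<^sup>T) t k n"
proof (rule has_mat_derivativeI)
  fix i j assume ij: "i < k" "j < n"
  then have "(\<lambda>s. (F s)\<^sup>T $$ (i, j)) = (\<lambda>s. F s $$ (j, i))"
    using has_mat_derivativeD(1)[OF F] by (metis carrier_matD index_transpose_mat(1))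
  then show "((\<lambda>s. (F s)\<^sup>T $$ (i, j)) has_field_derivative D\<^sup>T $$ (i, j)) (at t)"
    using ij has_mat_derivativeD(2)[OF F]
    by (auto intro!: has_mat_derivativeD(3)[OF F])
qed (use has_mat_derivativeD[OF F] in auto)

lemma upper_part_carrier [simp]: "A \<in> carrier_mat n k \<Longrightarrow> upper_part A \<in> carrier_mat n k"
  by (auto simp: upper_part_def)

lemma index_upper_part:
  "A \<in> carrier_mat n k \<Longrightarrow> i < n \<Longrightarrow> j < k \<Longrightarrow>
    upper_part A $$ (i, j) = (if i \<le> j then A $$ (i, j) else 0)"
  by (auto simp: upper_part_def)

lemma has_mat_derivative_upper_part:
  assumes F: "has_mat_derivative F D t n k"
  shows "has_mat_derivative (\<lambda>s. upper_part (F s)) (upper_part D) t n k"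
proof (rule has_mat_derivativeI)
  fix i j assume ij: "i < n" "j < k"
  have "(\<lambda>s. upper_part (F s) $$ (i, j)) = (\<lambda>s. if i \<le> j then F s $$ (i, j) else 0)"
    using index_upper_part[OF has_mat_derivativeD(1)[OF F] ij] by auto
  then show "((\<lambda>s. upper_part (F s) $$ (i, j)) has_field_derivative upper_part D $$ (i, j)) (at t)"
    using has_mat_derivativeD(3)[OF F ij] index_upper_part[OF has_mat_derivativeD(2)[OF F] ij]
    by auto
qed (use has_mat_derivativeD[OF F] in auto)

lemma index_mult_mat_sum:
  assumes "A \<in> carrier_mat n k" and "B \<in> carrier_mat k l" and "i < n" and "j < l"
  shows "(A * B) $$ (i, j) = (\<Sum>p<k. A $$ (i, p) * B $$ (p, j))"
  using assms by (auto simp: scalar_prod_def atLeast0LessThan intro!: sum.cong)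

lemma has_mat_derivative_mult:
  assumes F: "has_mat_derivative F D t n k" and G: "has_mat_derivative G E t k l"
  shows "has_mat_derivative (\<lambda>s. F s * G s) (D * G t + F t * E) t n l"
proof (rule has_mat_derivativeI)
  fix i j assume ij: "i < n" "j < l"
  note FD = has_mat_derivativeD[OF F] and GD = has_mat_derivativeD[OF G]
  have "(\<lambda>s. (F s * G s) $$ (i, j)) = (\<lambda>s. \<Sum>p<k. F s $$ (i, p) * G s $$ (p, j))"
    using index_mult_mat_sum[OF FD(1) GD(1) ij] by auto
  moreover have "(D * G t + F t * E) $$ (i, j) = (D * G t) $$ (i, j) + (F t * E) $$ (i, j)"
    using ij FD(1)[of t] GD(2) by auto
  moreover have "\<dots> = (\<Sum>p<k. D $$ (i, p) * G t $$ (p, j) + F t $$ (i, p) * E $$ (p, j))"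
    using index_mult_mat_sum[OF FD(2) GD(1) ij] index_mult_mat_sum[OF FD(1) GD(2) ij]
    by (simp add: sum.distrib)
  moreover have "((\<lambda>s. \<Sum>p<k. F s $$ (i, p) * G s $$ (p, j)) has_field_derivative
      (\<Sum>p<k. D $$ (i, p) * G t $$ (p, j) + F t $$ (i, p) * E $$ (p, j))) (at t)"
    using ij by (intro DERIV_sum) (auto intro!: derivative_eq_intros FD(3) GD(3))
  ultimately show "((\<lambda>s. (F s * G s) $$ (i, j)) has_field_derivative
      (D * G t + F t * E) $$ (i, j)) (at t)" by simp
qed (use has_mat_derivativeD[OF F] has_mat_derivativeD[OF G] in
      \<open>blast intro: mult_carrier_mat add_carrier_mat\<close>)+

text \<open>The product rule applied to \<open>H\<close>: each summand replaces one of the factors \<open>X\<close> by the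
  direction \<open>Z\<close>.\<close>

definition H_derivative :: "real mat \<Rightarrow> real \<Rightarrow> real mat \<Rightarrow> real mat \<Rightarrow> real mat" where
  "H_derivative C \<eta> X Z = Z + \<eta> \<cdot>\<^sub>m (C * Z -
     (Z * upper_part (X\<^sup>T * C * X) + X * upper_part (Z\<^sup>T * C * X + X\<^sup>T * C * Z)))"

lemma has_mat_derivative_H_map:
  assumes C: "C \<in> carrier_mat d d" and X: "X \<in> carrier_mat d m" and Z: "Z \<in> carrier_mat d m"
  shows "has_mat_derivative (\<lambda>t. H_map C \<eta> (X + t \<cdot>\<^sub>m Z)) (H_derivative C \<eta> X Z) 0 d m"
proof -
  let ?Y = "\<lambda>t. X + t \<cdot>\<^sub>m Z"
  note Y = has_mat_derivative_line[OF X Z, of 0]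
  have Y0: "?Y 0 = X" using X Z by auto
  have const_mult: "0\<^sub>m d d * X + C * Z = C * Z" using C X Z by simp
  have "has_mat_derivative (\<lambda>t. (?Y t)\<^sup>T * C) (Z\<^sup>T * C) 0 m d"
    using has_mat_derivative_mult[OF has_mat_derivative_transpose[OF Y]
        has_mat_derivative_const[OF C]] C X Z by (simp add: Y0)
  from has_mat_derivative_mult[OF this Y]
  have "has_mat_derivative (\<lambda>t. (?Y t)\<^sup>T * C * ?Y t) (Z\<^sup>T * C * X + X\<^sup>T * C * Z) 0 m m"
    by (simp add: Y0)
  from has_mat_derivative_mult[OF Y has_mat_derivative_upper_part[OF this]]
  have "has_mat_derivative (\<lambda>t. ?Y t * upper_part ((?Y t)\<^sup>T * C * ?Y t))
      (Z * upper_part (X\<^sup>T * C * X) + X * upper_part (Z\<^sup>T * C * X + X\<^sup>T * C * Z)) 0 d m"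
    by (simp add: Y0)
  moreover have "has_mat_derivative (\<lambda>t. C * ?Y t) (C * Z) 0 d m"
    using has_mat_derivative_mult[OF has_mat_derivative_const[OF C] Y] C Z X
    by (simp add: Y0 const_mult)
  ultimately show ?thesis
    unfolding H_map_def H_derivative_def
    by (intro has_mat_derivative_add has_mat_derivative_smult has_mat_derivative_minus Y)
qed

lemma index_jacobian_mat_H_map:
  assumes C: "C \<in> carrier_mat d d" and X: "X \<in> carrier_mat d m"
    and p: "p < d * m" and q: "q < d * m"
  shows "jacobian_mat d m (H_map C \<eta>) X $$ (p, q) =
    H_derivative C \<eta> X (mat_unit d m (q mod d) (q div d)) $$ (p mod d, p div d)"
proof -
  have d: "0 < d" using p by (cases d) auto
  have "p mod d < d" "p div d < m"
    using p d by (simp_all add: less_mult_imp_div_less mult.commute)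
  moreover have "mat_unit d m k l \<in> carrier_mat d m" for k l by (simp add: mat_unit_def)
  ultimately show ?thesis
    using p q has_mat_derivativeD(3)[OF has_mat_derivative_H_map[OF C X]]
    by (auto simp: jacobian_mat_def intro!: DERIV_imp_deriv)
qed

section \<open>The linearised iteration at a matrix of principal eigenvectors\<close>

locale principal_components =
  fixes d m :: nat and C X :: "real mat" and lam :: "nat \<Rightarrow> real"
  assumes C: "C \<in> carrier_mat d d" and sym: "C\<^sup>T = C"
    and X: "X \<in> carrier_mat d m"
    and eigen: "\<And>i. i < m \<Longrightarrow> C *\<^sub>v col X i = lam i \<cdot>\<^sub>v col X i"
    and orth: "X\<^sup>T * X = 1\<^sub>m m"
begin

lemma C_entry_commute: "i < d \<Longrightarrow> k < d \<Longrightarrow> C $$ (i, k) = C $$ (k, i)"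
  using C sym by (metis carrier_matD index_transpose_mat(1))

lemma index_CX:
  assumes "i < d" and "p < m"
  shows "(C * X) $$ (i, p) = lam p * X $$ (i, p)"
proof -
  have "(C * X) $$ (i, p) = (C *\<^sub>v col X p) $ i" using C X assms by simp
  also have "\<dots> = lam p * X $$ (i, p)"
    unfolding eigen[OF assms(2)] using X assms by simp
  finally show ?thesis .
qed

lemma eigen_entry:
  assumes "i < d" and "p < m"
  shows "(\<Sum>k<d. C $$ (i, k) * X $$ (k, p)) = lam p * X $$ (i, p)"
  using index_CX[OF assms] index_mult_mat_sum[OF C X assms] by simp

lemma orth_entry:
  assumes "p < m" and "q < m"
  shows "(\<Sum>k<d. X $$ (k, p) * X $$ (k, q)) = (if p = q then 1 else 0)"
proof -
  have "(X\<^sup>T * X) $$ (p, q) = (\<Sum>k<d. X\<^sup>T $$ (p, k) * X $$ (k, q))"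
    by (rule index_mult_mat_sum) (use X assms in auto)
  then show ?thesis unfolding orth using X assms by simp
qed

lemma index_ZtCX:
  assumes Z: "Z \<in> carrier_mat d m" and p: "p < m" "j < m"
  shows "(Z\<^sup>T * C * X) $$ (p, j) = lam j * (\<Sum>k<d. X $$ (k, j) * Z $$ (k, p))"
proof -
  have "(Z\<^sup>T * C * X) = Z\<^sup>T * (C * X)"
    by (rule assoc_mult_mat) (use C X Z in auto)
  also have "\<dots> $$ (p, j) = (\<Sum>k<d. Z\<^sup>T $$ (p, k) * (C * X) $$ (k, j))"
    by (rule index_mult_mat_sum) (use C X Z p in auto)
  also have "\<dots> = (\<Sum>k<d. lam j * (X $$ (k, j) * Z $$ (k, p)))"
    using Z p by (intro sum.cong) (auto simp: index_CX)
  finally show ?thesis by (simp add: sum_distrib_left)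
qed

lemma index_XtCZ:
  assumes Z: "Z \<in> carrier_mat d m" and p: "p < m" "j < m"
  shows "(X\<^sup>T * C * Z) $$ (p, j) = lam p * (\<Sum>k<d. X $$ (k, p) * Z $$ (k, j))"
proof -
  have "X\<^sup>T * C = (C * X)\<^sup>T" using C X sym by (simp add: transpose_mult)
  then have "(X\<^sup>T * C * Z) $$ (p, j) = (\<Sum>k<d. (C * X)\<^sup>T $$ (p, k) * Z $$ (k, j))"
    using index_mult_mat_sum[of "(C * X)\<^sup>T" m d Z m p j] C X Z p by simp
  also have "\<dots> = (\<Sum>k<d. lam p * (X $$ (k, p) * Z $$ (k, j)))"
    using C X p by (intro sum.cong) (auto simp: index_CX simp del: index_mult_mat(1))
  finally show ?thesis by (simp add: sum_distrib_left)
qed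

text \<open>The eigenvectors of the Jacobian are complex vectors of length \<open>d * m\<close>. They are studied as
  functions of a row and a column index, which avoids complex copies of all real matrices involved.
  The matrix \<open>proj z\<close> is \<open>X\<^sup>T z\<close>.\<close>

definition proj :: "(nat \<Rightarrow> nat \<Rightarrow> complex) \<Rightarrow> nat \<Rightarrow> nat \<Rightarrow> complex" where
  "proj z p j = (\<Sum>k<d. of_real (X $$ (k, p)) * z k j)"

text \<open>The complexified differential of \<open>H\<close> at the eigenvector matrix \<open>X\<close>, with \<open>C X = X \<Lambda>\<close> and
  \<open>X\<^sup>T C X = \<Lambda>\<close> already inserted.\<close>

definition H_lin :: "real \<Rightarrow> (nat \<Rightarrow> nat \<Rightarrow> complex) \<Rightarrow> nat \<Rightarrow> nat \<Rightarrow> complex" where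
  "H_lin \<eta> z i j = of_real (1 - \<eta> * lam j) * z i j + of_real \<eta> *
     ((\<Sum>k<d. of_real (C $$ (i, k)) * z k j) -
      (\<Sum>p<m. of_real (X $$ (i, p)) *
        (if p \<le> j then of_real (lam j) * proj z j p + of_real (lam p) * proj z p j else 0)))"

lemma H_lin_of_real:
  assumes Z: "Z \<in> carrier_mat d m" and ij: "i < d" "j < m"
  shows "complex_of_real (H_derivative C \<eta> X Z $$ (i, j)) =
    H_lin \<eta> (\<lambda>k l. of_real (Z $$ (k, l))) i j"
proof -
  let ?U = "upper_part (X\<^sup>T * C * X)" and ?V = "Z\<^sup>T * C * X + X\<^sup>T * C * Z"
  have XCX: "X\<^sup>T * C * X \<in> carrier_mat m m" using C X by auto
  have V: "?V \<in> carrier_mat m m" using C X Z by auto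
  have "(Z * ?U) $$ (i, j) = (\<Sum>p<m. Z $$ (i, p) * ?U $$ (p, j))"
    by (rule index_mult_mat_sum) (use Z XCX ij in auto)
  also have "\<dots> = (\<Sum>p<m. if p = j then Z $$ (i, p) * lam j else 0)"
    using ij by (intro sum.cong)
      (auto simp: index_upper_part[OF XCX] index_ZtCX[OF X] orth_entry)
  also have "\<dots> = lam j * Z $$ (i, j)" using ij by simp
  finally have ZU: "(Z * ?U) $$ (i, j) = lam j * Z $$ (i, j)" .
  have "(X * upper_part ?V) $$ (i, j) = (\<Sum>p<m. X $$ (i, p) * upper_part ?V $$ (p, j))"
    by (rule index_mult_mat_sum) (use X V ij in auto)
  also have "\<dots> = (\<Sum>p<m. X $$ (i, p) *
      (if p \<le> j then lam j * (\<Sum>k<d. X $$ (k, j) * Z $$ (k, p))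
        + lam p * (\<Sum>k<d. X $$ (k, p) * Z $$ (k, j)) else 0))"
  proof (intro sum.cong refl)
    fix p assume "p \<in> {..<m}"
    then have p: "p < m" by simp
    have "?V $$ (p, j) = (Z\<^sup>T * C * X) $$ (p, j) + (X\<^sup>T * C * Z) $$ (p, j)"
      using X Z p ij by simp
    then show "X $$ (i, p) * upper_part ?V $$ (p, j) = X $$ (i, p) *
      (if p \<le> j then lam j * (\<Sum>k<d. X $$ (k, j) * Z $$ (k, p))
        + lam p * (\<Sum>k<d. X $$ (k, p) * Z $$ (k, j)) else 0)"
      using index_upper_part[OF V p ij(2)] index_ZtCX[OF Z p ij(2)] index_XtCZ[OF Z p ij(2)]
      by simp
  qed
  finally have XV: "(X * upper_part ?V) $$ (i, j) = \<dots>" .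
  have "H_derivative C \<eta> X Z $$ (i, j) =
      Z $$ (i, j) + \<eta> * ((C * Z) $$ (i, j) - ((Z * ?U) $$ (i, j) + (X * upper_part ?V) $$ (i, j)))"
  proof -
    have "Z * ?U \<in> carrier_mat d m" and "X * upper_part ?V \<in> carrier_mat d m"
      and "C * Z \<in> carrier_mat d m"
      using C X Z XCX V by (blast intro: mult_carrier_mat upper_part_carrier)+
    moreover have "(Z + \<eta> \<cdot>\<^sub>m (A - (P + Q))) $$ (i, j) =
        Z $$ (i, j) + \<eta> * (A $$ (i, j) - (P $$ (i, j) + Q $$ (i, j)))"
      if "P \<in> carrier_mat d m" "Q \<in> carrier_mat d m" "A \<in> carrier_mat d m" for P Q A
      using that Z ij by simp
    ultimately show ?thesis unfolding H_derivative_def by blast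
  qed
  also have "complex_of_real \<dots> = H_lin \<eta> (\<lambda>k l. of_real (Z $$ (k, l))) i j"
    unfolding ZU XV index_mult_mat_sum[OF C Z ij] H_lin_def proj_def
    by (simp add: algebra_simps if_distrib[of complex_of_real] cong: if_cong)
  finally show ?thesis .
qed

lemma proj_add_smult:
  "proj (\<lambda>k l. a * z k l + w k l) p j = a * proj z p j + proj w p j"
  unfolding proj_def by (simp add: sum.distrib sum_distrib_left algebra_simps)

lemma H_lin_add_smult:
  "H_lin \<eta> (\<lambda>k l. a * z k l + w k l) i j = a * H_lin \<eta> z i j + H_lin \<eta> w i j"
proof -
  have 1: "(\<Sum>k<d. of_real (C $$ (i, k)) * (a * z k j + w k j)) =
      a * (\<Sum>k<d. of_real (C $$ (i, k)) * z k j) + (\<Sum>k<d. of_real (C $$ (i, k)) * w k j)"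
    by (simp add: sum.distrib sum_distrib_left algebra_simps)
  let ?g = "\<lambda>z p. of_real (X $$ (i, p)) *
        (if p \<le> j then of_real (lam j) * proj z j p + of_real (lam p) * proj z p j else 0)"
  have 2: "(\<Sum>p<m. ?g (\<lambda>k l. a * z k l + w k l) p) = a * (\<Sum>p<m. ?g z p) + (\<Sum>p<m. ?g w p)"
    unfolding sum_distrib_left sum.distrib[symmetric] proj_add_smult
    by (intro sum.cong) (auto simp: algebra_simps)
  show ?thesis unfolding H_lin_def 1 2 by (simp add: algebra_simps)
qed

lemma H_lin_sum:
  assumes "finite S"
  shows "H_lin \<eta> (\<lambda>k l. \<Sum>q\<in>S. a q * z q k l) i j = (\<Sum>q\<in>S. a q * H_lin \<eta> (z q) i j)"
  using assms
proof induction
  case empty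
  show ?case by (simp add: H_lin_def proj_def cong: if_cong)
next
  case (insert q S)
  then show ?case by (simp add: H_lin_add_smult)
qed

lemma H_lin_cong:
  assumes "\<And>k l. k < d \<Longrightarrow> l < m \<Longrightarrow> z k l = w k l" and ij: "i < d" "j < m"
  shows "H_lin \<eta> z i j = H_lin \<eta> w i j"
proof -
  have "proj z p l = proj w p l" if "l < m" for p l
    unfolding proj_def using assms(1) that by (intro sum.cong) auto
  then show ?thesis
    unfolding H_lin_def using assms by (auto intro!: sum.cong arg_cong2[of _ _ _ _ "(-)"])
qed

text \<open>Column \<open>q\<close> of the Jacobian is the differential applied to a matrix unit, and the matrix units
  weighted with the entries of \<open>v\<close> add up to the matrix that \<open>v\<close> represents.\<close>

lemma jacobian_mult_vec:
  assumes v: "v \<in> carrier_vec (d * m)" and ij: "i < d" "j < m"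
  shows "(map_mat complex_of_real (jacobian_mat d m (H_map C \<eta>) X) *\<^sub>v v) $ (j * d + i) =
    H_lin \<eta> (\<lambda>k l. v $ (l * d + k)) i j"
proof -
  let ?J = "jacobian_mat d m (H_map C \<eta>) X"
  let ?E = "\<lambda>q. mat_unit d m (q mod d) (q div d)"
  have pos: "l * d + k < d * m" if "k < d" "l < m" for k l
  proof -
    have "l * d + k < Suc l * d" using that by simp
    also have "\<dots> \<le> m * d" using that by (intro mult_le_mono1) simp
    finally show ?thesis by (simp add: mult.commute)
  qed
  let ?p = "j * d + i"
  have p: "?p < d * m" "?p mod d = i" "?p div d = j" using pos[OF ij] ij by auto
  have "(map_mat complex_of_real ?J *\<^sub>v v) $ ?p =
      (\<Sum>q<d * m. v $ q * complex_of_real (?J $$ (?p, q)))"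
    using v p(1) by (simp add: scalar_prod_def jacobian_mat_def atLeast0LessThan mult.commute)
  also have "\<dots> = (\<Sum>q<d * m. v $ q * H_lin \<eta> (\<lambda>k l. of_real (?E q $$ (k, l))) i j)"
  proof (intro sum.cong refl)
    fix q assume "q \<in> {..<d * m}"
    moreover have "?E q \<in> carrier_mat d m" by (simp add: mat_unit_def)
    ultimately show "v $ q * complex_of_real (?J $$ (?p, q)) =
        v $ q * H_lin \<eta> (\<lambda>k l. of_real (?E q $$ (k, l))) i j"
      using index_jacobian_mat_H_map[OF C X p(1), of q] H_lin_of_real[of "?E q"] p ij by simp
  qed
  also have "\<dots> = H_lin \<eta> (\<lambda>k l. \<Sum>q<d * m. v $ q * of_real (?E q $$ (k, l))) i j"
    by (simp add: H_lin_sum)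
  also have "\<dots> = H_lin \<eta> (\<lambda>k l. v $ (l * d + k)) i j"
  proof (rule H_lin_cong[OF _ ij])
    fix k l assume kl: "k < d" "l < m"
    have "(\<Sum>q<d * m. v $ q * of_real (?E q $$ (k, l))) =
        (\<Sum>q<d * m. if q = l * d + k then v $ q else 0)"
    proof (intro sum.cong refl)
      fix q
      have "k = q mod d \<and> l = q div d \<longleftrightarrow> q = l * d + k"
        using kl by (metis add.commute div_mult_mod_eq div_mult_self1 div_less mod_less
            mod_mult_self1 add_0 less_nat_zero_code)
      then show "v $ q * of_real (?E q $$ (k, l)) = (if q = l * d + k then v $ q else 0)"
        using kl by (auto simp: mat_unit_def)
    qed
    also have "\<dots> = v $ (l * d + k)" using pos[OF kl] by simp
    finally show "(\<Sum>q<d * m. v $ q * of_real (?E q $$ (k, l))) = v $ (l * d + k)" .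
  qed
  finally show ?thesis .
qed

text \<open>The triangular system. Symmetry of \<open>C\<close> makes \<open>x\<^sub>r\<close> a left eigenvector, and orthonormality
  leaves only the summand \<open>p = r\<close> of the last sum in the differential.\<close>

lemma proj_H_lin:
  assumes r: "r < m" and j: "j < m"
  shows "proj (H_lin \<eta> z) r j = of_real (1 - \<eta> * (lam j - lam r)) * proj z r j -
    (if r \<le> j then of_real \<eta> * (of_real (lam j) * proj z j r + of_real (lam r) * proj z r j) else 0)"
proof -
  let ?x = "\<lambda>i p. complex_of_real (X $$ (i, p))" and ?c = "\<lambda>i k. complex_of_real (C $$ (i, k))"
  let ?g = "\<lambda>p. if p \<le> j then of_real (lam j) * proj z j p + of_real (lam p) * proj z p j else 0"
  have "(\<Sum>i<d. ?x i r * (\<Sum>k<d. ?c i k * z k j)) = (\<Sum>i<d. \<Sum>k<d. ?c i k * ?x i r * z k j)"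
    by (simp add: sum_distrib_left mult_ac)
  also have "\<dots> = (\<Sum>k<d. \<Sum>i<d. ?c i k * ?x i r * z k j)" by (rule sum.swap)
  also have "\<dots> = (\<Sum>k<d. of_real (\<Sum>i<d. C $$ (k, i) * X $$ (i, r)) * z k j)"
    by (intro sum.cong refl) (auto simp: sum_distrib_right C_entry_commute intro!: sum.cong)
  also have "\<dots> = of_real (lam r) * proj z r j"
    unfolding proj_def sum_distrib_left
    by (intro sum.cong refl) (use r in \<open>auto simp: eigen_entry simp del: of_real_sum\<close>)
  finally have 1: "(\<Sum>i<d. ?x i r * (\<Sum>k<d. ?c i k * z k j)) = of_real (lam r) * proj z r j" .
  have "(\<Sum>i<d. ?x i r * (\<Sum>p<m. ?x i p * ?g p)) = (\<Sum>i<d. \<Sum>p<m. ?x i r * ?x i p * ?g p)"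
    by (simp add: sum_distrib_left mult.assoc)
  also have "\<dots> = (\<Sum>p<m. \<Sum>i<d. ?x i r * ?x i p * ?g p)" by (rule sum.swap)
  also have "\<dots> = (\<Sum>p<m. of_real (\<Sum>i<d. X $$ (i, r) * X $$ (i, p)) * ?g p)"
    by (simp add: sum_distrib_right)
  also have "\<dots> = (\<Sum>p<m. if p = r then ?g p else 0)"
    by (intro sum.cong refl) (use r in \<open>auto simp: orth_entry simp del: of_real_sum\<close>)
  also have "\<dots> = ?g r" using r by simp
  finally have 2: "(\<Sum>i<d. ?x i r * (\<Sum>p<m. ?x i p * ?g p)) = ?g r" .
  have "proj (H_lin \<eta> z) r j = (\<Sum>i<d. of_real (1 - \<eta> * lam j) * (?x i r * z i j) +
      of_real \<eta> * (?x i r * (\<Sum>k<d. ?c i k * z k j) - ?x i r * (\<Sum>p<m. ?x i p * ?g p)))"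
    unfolding proj_def[of "H_lin \<eta> z"] H_lin_def by (simp add: algebra_simps)
  also have "\<dots> = of_real (1 - \<eta> * lam j) * proj z r j +
      of_real \<eta> * (of_real (lam r) * proj z r j - ?g r)"
    unfolding sum.distrib sum_distrib_left[symmetric] sum_subtractf 1 2 by (simp add: proj_def)
  finally show ?thesis by (cases "r \<le> j") (simp_all add: algebra_simps)
qed

text \<open>If \<open>\<nu>\<close> were one of the leading eigenvalues, \<open>w\<close> would be a multiple of the corresponding
  column of \<open>X\<close>, to which it is also orthogonal.\<close>

lemma eigenvector_orthogonal_to_principal:
  assumes cp: "char_poly C = (\<Prod>i<d. [:- lam i, 1:])"
    and simple: "\<And>i k. i < m \<Longrightarrow> k < d \<Longrightarrow> k \<noteq> i \<Longrightarrow> lam k \<noteq> lam i"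
    and w: "eigenvector (map_mat complex_of_real C) w \<nu>"
    and perp: "\<And>p. p < m \<Longrightarrow> (\<Sum>k<d. of_real (X $$ (k, p)) * w $ k) = 0"
  obtains r where "m \<le> r" and "r < d" and "\<nu> = of_real (lam r)"
proof -
  let ?C = "map_mat complex_of_real C"
  have CC: "?C \<in> carrier_mat d d" using C by simp
  have wD: "w \<in> carrier_vec d" "w \<noteq> 0\<^sub>v d" "?C *\<^sub>v w = \<nu> \<cdot>\<^sub>v w"
    using w C by (auto simp: eigenvector_def)
  interpret of_real_poly: map_poly_comm_ring_hom "of_real :: real \<Rightarrow> complex" ..
  have cpC: "char_poly ?C = (\<Prod>i<d. [:- of_real (lam i), 1:])"
    unfolding of_real_hom.char_poly_hom[OF C] cp by (simp add: of_real_poly.hom_prod)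
  have "poly (char_poly ?C) \<nu> = 0"
    using w eigenvalue_root_char_poly[OF CC] by (auto simp: eigenvalue_def)
  then obtain r where r: "r < d" "\<nu> = of_real (lam r)"
    unfolding cpC by (auto simp: poly_prod)
  have "m \<le> r"
  proof (rule ccontr)
    assume "\<not> m \<le> r"
    then have rm: "r < m" by simp
    define es where "es = map (\<lambda>k. complex_of_real (lam k)) (filter (\<lambda>k. k \<noteq> r) [0..<d])"
    have "char_poly ?C = [:- \<nu>, 1:] * (\<Prod>i\<in>{..<d} - {r}. [:- of_real (lam i), 1:])"
      unfolding cpC r(2) using r(1) by (intro prod.remove) auto
    also have "(\<Prod>i\<in>{..<d} - {r}. [:- complex_of_real (lam i), 1:]) = (\<Prod>a\<leftarrow>es. [:- a, 1:])"
    proof -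
      have "set (filter (\<lambda>k. k \<noteq> r) [0..<d]) = {..<d} - {r}" by auto
      then show ?thesis
        using prod.distinct_set_conv_list[of "filter (\<lambda>k. k \<noteq> r) [0..<d]"
            "\<lambda>i. [:- complex_of_real (lam i), 1:]"]
        by (simp add: es_def comp_def)
    qed
    finally have cp': "char_poly ?C = (\<Prod>a\<leftarrow>\<nu> # es. [:- a, 1:])" by simp
    have "lam r \<noteq> lam k" if "k < d" "k \<noteq> r" for k
      using simple[OF rm that] by simp
    then have notin: "\<nu> \<notin> set es" unfolding es_def r(2) by auto
    let ?x = "map_vec complex_of_real (col X r)"
    have x: "?x \<in> carrier_vec d" using X by (intro carrier_vecI) simp
    have xe: "?C *\<^sub>v ?x = \<nu> \<cdot>\<^sub>v ?x"
    proof (rule eq_vecI)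
      fix i assume "i < dim_vec (\<nu> \<cdot>\<^sub>v ?x)"
      then have i: "i < d" using X by simp
      have "(?C *\<^sub>v ?x) $ i = of_real (\<Sum>k<d. C $$ (i, k) * X $$ (k, r))"
        using C X i rm by (simp add: scalar_prod_def atLeast0LessThan)
      also have "\<dots> = (\<nu> \<cdot>\<^sub>v ?x) $ i" using X i rm r(2) by (simp add: eigen_entry del: of_real_sum)
      finally show "(?C *\<^sub>v ?x) $ i = (\<nu> \<cdot>\<^sub>v ?x) $ i" .
    qed (use C X in simp)
    have norm1: "(\<Sum>k<d. of_real (X $$ (k, r)) * ?x $ k) = 1"
    proof -
      have "(\<Sum>k<d. of_real (X $$ (k, r)) * ?x $ k) = of_real (\<Sum>k<d. X $$ (k, r) * X $$ (k, r))"
        using X rm by simp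
      then show ?thesis using orth_entry[OF rm rm] by (simp del: of_real_sum)
    qed
    then have x0: "?x \<noteq> 0\<^sub>v d" by auto
    obtain c where c: "w = c \<cdot>\<^sub>v ?x"
      by (rule simple_eigenvalue_eigenvectors_parallel[OF CC cp' notin x xe x0 wD(1,3)])
    have "0 = (\<Sum>k<d. of_real (X $$ (k, r)) * w $ k)" using perp[OF rm] by simp
    also have "\<dots> = (\<Sum>k<d. c * (of_real (X $$ (k, r)) * ?x $ k))"
      unfolding c using X by (intro sum.cong) auto
    also have "\<dots> = c" unfolding sum_distrib_left[symmetric] norm1 by simp
    finally have "w = 0\<^sub>v d" using c X by auto
    with wD(2) show False by simp
  qed
  with r show thesis by (intro that)
qed

lemma H_lin_eigenvalue_cases:
  assumes cp: "char_poly C = (\<Prod>i<d. [:- lam i, 1:])"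
    and simple: "\<And>i k. i < m \<Longrightarrow> k < d \<Longrightarrow> k \<noteq> i \<Longrightarrow> lam k \<noteq> lam i"
    and m_le_d: "m \<le> d" and \<eta>: "\<eta> \<noteq> 0"
    and ev: "\<And>i j. i < d \<Longrightarrow> j < m \<Longrightarrow> H_lin \<eta> z i j = \<mu> * z i j"
    and nz: "i < d" "j < m" "z i j \<noteq> 0"
  obtains s l where "\<mu> = of_real (1 - \<eta> * s)" and "l < m"
    and "s = lam l \<or> s = 2 * lam l \<or> (\<exists>r. l < r \<and> r < d \<and> s = lam l - lam r)"
proof -
  have proj_ev: "\<mu> * proj z r l = of_real (1 - \<eta> * (lam l - lam r)) * proj z r l -
      (if r \<le> l then of_real \<eta> * (of_real (lam l) * proj z l r + of_real (lam r) * proj z r l) else 0)"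
    if "r < m" "l < m" for r l
  proof -
    have "proj (H_lin \<eta> z) r l = \<mu> * proj z r l"
      unfolding proj_def[of "H_lin \<eta> z"] proj_def[of z] sum_distrib_left
      using ev that by (intro sum.cong) auto
    then show ?thesis using proj_H_lin[OF that] by simp
  qed
  have cancel: "\<mu> = of_real a" if "\<mu> * y = of_real a * y" "y \<noteq> 0" for a and y :: complex
    using that by simp
  (* A nonzero entry of X\<^sup>T z below the diagonal determines the eigenvalue by itself. If there is
     none, the coupling of the entries above the diagonal to those below disappears, and any nonzero
     entry on or above the diagonal determines the eigenvalue. *)
  consider (below) r l where "r < m" "l < r" "proj z r l \<noteq> 0"
    | (above) r l where "l < m" "r \<le> l" "proj z r l \<noteq> 0" "r < l \<Longrightarrow> proj z l r = 0"
    | (perp) "\<And>r l. r < m \<Longrightarrow> l < m \<Longrightarrow> proj z r l = 0"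
  proof (cases "\<exists>r<m. \<exists>l<m. proj z r l \<noteq> 0")
    case True
    then show ?thesis using that(1,2) by (metis linorder_not_less less_le)
  next
    case False
    then show ?thesis using that(3) by blast
  qed
  then show thesis
  proof cases
    case below
    then have "\<mu> = of_real (1 - \<eta> * (lam l - lam r))"
      using proj_ev[of r l] by (intro cancel[of "proj z r l"]) auto
    then show thesis using below m_le_d by (intro that[of "lam l - lam r" l]) auto
  next
    case above
    show thesis
    proof (cases "r = l")
      case True
      then have "\<mu> = of_real (1 - \<eta> * (2 * lam l))"
        using proj_ev[of l l] above
        by (intro cancel[of "proj z l l"]) (auto simp: algebra_simps)
      then show thesis using above(1) by (intro that[of "2 * lam l" l]) auto
    next
      case False
      then have "\<mu> = of_real (1 - \<eta> * lam l)"
        using proj_ev[of r l] above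
        by (intro cancel[of "proj z r l"]) (auto simp: algebra_simps)
      then show thesis using above(1) by (intro that[of "lam l" l]) auto
    qed
  next
    case perp
    let ?C = "map_mat complex_of_real C"
    define w where "w = vec d (\<lambda>k. z k j)"
    (* Solving \<mu> = 1 + \<eta> (\<nu> - \<lambda>\<^sub>j) for the eigenvalue \<nu> of C on the column z\<^sub>j. *)
    define \<nu> where "\<nu> = (\<mu> - 1) / of_real \<eta> + of_real (lam j)"
    have \<eta>\<nu>: "of_real \<eta> * \<nu> = \<mu> - 1 + of_real \<eta> * of_real (lam j)"
      using \<eta> by (simp add: \<nu>_def distrib_left)
    have "?C *\<^sub>v w = \<nu> \<cdot>\<^sub>v w"
    proof (rule eq_vecI)
      fix k assume "k < dim_vec (\<nu> \<cdot>\<^sub>v w)"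
      then have k: "k < d" by (simp add: w_def)
      have "H_lin \<eta> z k j = of_real (1 - \<eta> * lam j) * z k j +
          of_real \<eta> * (\<Sum>l<d. of_real (C $$ (k, l)) * z l j)"
        unfolding H_lin_def using perp nz(2) by (simp add: sum.neutral cong: if_cong)
      with ev[OF k nz(2)]
      have "of_real \<eta> * (\<Sum>l<d. of_real (C $$ (k, l)) * z l j) = of_real \<eta> * (\<nu> * z k j)"
        unfolding mult.assoc[symmetric] \<eta>\<nu> by (simp add: algebra_simps)
      then show "(?C *\<^sub>v w) $ k = (\<nu> \<cdot>\<^sub>v w) $ k"
        using \<eta> C k by (simp add: scalar_prod_def atLeast0LessThan w_def)
    qed (use C in \<open>simp add: w_def\<close>)
    moreover have "w \<noteq> 0\<^sub>v d"
    proof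
      assume "w = 0\<^sub>v d"
      from arg_cong[OF this, of "\<lambda>u. u $ i"] nz show False by (simp add: w_def)
    qed
    ultimately have evw: "eigenvector ?C w \<nu>" using C by (simp add: eigenvector_def w_def)
    have perp_w: "(\<Sum>k<d. of_real (X $$ (k, p)) * w $ k) = 0" if "p < m" for p
      using perp[OF that nz(2)] by (simp add: proj_def w_def)
    obtain r where r: "m \<le> r" "r < d" "\<nu> = of_real (lam r)"
    proof (rule eigenvector_orthogonal_to_principal[OF cp _ evw])
      show "lam k \<noteq> lam i" if "i < m" "k < d" "k \<noteq> i" for i k
        using that by (rule simple)
      show "(\<Sum>k<d. of_real (X $$ (k, p)) * w $ k) = 0" if "p < m" for p
        using that by (rule perp_w)
    qed (rule that)
    have "\<mu> = 1 + of_real \<eta> * (\<nu> - of_real (lam j))" using \<eta>\<nu> by (simp add: algebra_simps)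
    then have "\<mu> = of_real (1 - \<eta> * (lam j - lam r))" by (simp add: r(3) algebra_simps)
    then show thesis using r nz(2) by (intro that[of "lam j - lam r" j] disjI2 exI[of _ r]) auto
  qed
qed

lemma jacobian_eigenvalue_cases:
  assumes cp: "char_poly C = (\<Prod>i<d. [:- lam i, 1:])"
    and simple: "\<And>i k. i < m \<Longrightarrow> k < d \<Longrightarrow> k \<noteq> i \<Longrightarrow> lam k \<noteq> lam i"
    and m_le_d: "m \<le> d" and \<eta>: "\<eta> \<noteq> 0"
    and ev: "eigenvalue (map_mat complex_of_real (jacobian_mat d m (H_map C \<eta>) X)) \<mu>"
  obtains s l where "\<mu> = of_real (1 - \<eta> * s)" and "l < m"
    and "s = lam l \<or> s = 2 * lam l \<or> (\<exists>r. l < r \<and> r < d \<and> s = lam l - lam r)"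
proof -
  let ?J = "map_mat complex_of_real (jacobian_mat d m (H_map C \<eta>) X)"
  obtain v where v: "v \<in> carrier_vec (d * m)" "v \<noteq> 0\<^sub>v (d * m)" "?J *\<^sub>v v = \<mu> \<cdot>\<^sub>v v"
    using ev by (auto simp: eigenvalue_def eigenvector_def jacobian_mat_def)
  define z where "z = (\<lambda>k l. v $ (l * d + k))"
  have "\<exists>p<d * m. v $ p \<noteq> 0"
  proof (rule ccontr)
    assume "\<not> ?thesis"
    then have "v = 0\<^sub>v (d * m)" using v(1) by (intro eq_vecI) auto
    with v(2) show False by simp
  qed
  then obtain p where p: "p < d * m" "v $ p \<noteq> 0" by blast
  then have d: "0 < d" by (cases d) auto
  have nz: "p mod d < d" "p div d < m" "z (p mod d) (p div d) \<noteq> 0"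
    using p d by (simp_all add: less_mult_imp_div_less mult.commute z_def)
  have evz: "H_lin \<eta> z i j = \<mu> * z i j" if ij: "i < d" "j < m" for i j
  proof -
    have "j * d + i < Suc j * d" using ij by simp
    also have "\<dots> \<le> m * d" using ij by (intro mult_le_mono1) simp
    finally have "j * d + i < dim_vec v" using v(1) by (simp add: mult.commute)
    then show ?thesis
      using jacobian_mult_vec[OF v(1) ij, of \<eta>] unfolding v(3) z_def by simp
  qed
  show thesis
  proof (rule H_lin_eigenvalue_cases[where z = z, OF cp _ m_le_d \<eta> _ nz])
    show "lam k \<noteq> lam i" if "i < m" "k < d" "k \<noteq> i" for i k
      using that by (rule simple)
    show "H_lin \<eta> z i j = \<mu> * z i j" if "i < d" "j < m" for i j
      using that by (rule evz)
  qed (rule that)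
qed

end

theorem theorem1:
  fixes d m :: nat and C X :: "real mat" and lam :: "nat \<Rightarrow> real"
  assumes "1 \<le> m" and "m \<le> d"
    and "C \<in> carrier_mat d d" and "positive_definite_mat C"
    and "char_poly C = (\<Prod>i<d. [:- lam i, 1:])"
    and "\<And>i. i < m \<Longrightarrow> Suc i < d \<Longrightarrow> lam i > lam (Suc i)"
    and "\<And>i. m \<le> i \<Longrightarrow> Suc i < d \<Longrightarrow> lam i \<ge> lam (Suc i)"
    and "\<And>i. i < d \<Longrightarrow> lam i > 0"
    and "X \<in> carrier_mat d m"
    and "\<And>i. i < m \<Longrightarrow> C *\<^sub>v col X i = lam i \<cdot>\<^sub>v col X i"
    and "X\<^sup>T * X = 1\<^sub>m m"
  shows "\<exists>\<eta>0 > 0. \<forall>\<eta>. 0 < \<eta> \<and> \<eta> < \<eta>0 \<longrightarrow>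
    spectral_radius (map_mat complex_of_real (jacobian_mat d m (H_map C \<eta>) X)) < 1"
proof -
  interpret principal_components d m C X lam
    by unfold_locales (use assms in \<open>auto simp: positive_definite_mat_def\<close>)
  have decreasing: "lam k < lam i" if "i < k" "i < m" "k < d" for i k
    using that
  proof (induction k rule: less_induct)
    case (less k)
    then obtain k' where k': "k = Suc k'" by (cases k) auto
    have step: "lam k \<le> lam k'" using assms(6)[of k'] assms(7)[of k'] less.prems k' by force
    show ?case
    proof (cases "k' = i")
      case True
      then show ?thesis using assms(6)[of i] less.prems k' by simp
    next
      case False
      then have "lam k' < lam i" using less.prems k' by (intro less.IH) auto
      with step show ?thesis by simp
    qed
  qed
  have simple: "lam k \<noteq> lam i" if "i < m" "k < d" "k \<noteq> i" for i k
    using decreasing[of i k] decreasing[of k i] that \<open>m \<le> d\<close> by (cases "i < k") force+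
  have lam0: "0 < lam 0" using assms(1,2,8) by simp
  have le_lam0: "lam l \<le> lam 0" if "l < m" for l
    using decreasing[of 0 l] that \<open>m \<le> d\<close> by (cases "l = 0") auto
  have "spectral_radius (map_mat complex_of_real (jacobian_mat d m (H_map C \<eta>) X)) < 1"
    if \<eta>: "0 < \<eta>" "\<eta> < 1 / lam 0" for \<eta>
  proof -
    let ?J = "map_mat complex_of_real (jacobian_mat d m (H_map C \<eta>) X)"
    have "?J \<in> carrier_mat (d * m) (d * m)" by (simp add: jacobian_mat_def)
    moreover have "0 < d * m" using assms(1,2) by simp
    ultimately obtain \<mu> where \<mu>: "spectral_radius ?J = norm \<mu>" "eigenvalue ?J \<mu>"
      using spectral_radius_mem_max(1)[of ?J "d * m"] by (auto simp: spectrum_def)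
    have "\<eta> \<noteq> 0" using \<eta> by simp
    obtain s l where sl: "\<mu> = of_real (1 - \<eta> * s)" "l < m"
      "s = lam l \<or> s = 2 * lam l \<or> (\<exists>r. l < r \<and> r < d \<and> s = lam l - lam r)"
    proof (rule jacobian_eigenvalue_cases[OF assms(5) _ \<open>m \<le> d\<close> \<open>\<eta> \<noteq> 0\<close> \<mu>(2)])
      show "lam k \<noteq> lam i" if "i < m" "k < d" "k \<noteq> i" for i k
        using that by (rule simple)
    qed (rule that)
    have "0 < s"
      using sl(2,3) assms(8)[of l] decreasing[of l] \<open>m \<le> d\<close> by auto
    moreover have "s \<le> 2 * lam 0"
      using sl(3) le_lam0[OF sl(2)] lam0 assms(8) by (auto dest!: assms(8))
    ultimately have "0 < \<eta> * s" "\<eta> * s < 2"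
    proof -
      show "0 < \<eta> * s" using \<eta> \<open>0 < s\<close> by simp
      have "\<eta> * s \<le> \<eta> * (2 * lam 0)" using \<eta> \<open>s \<le> 2 * lam 0\<close> by simp
      also have "\<dots> < 2" using \<eta> lam0 by (simp add: field_simps)
      finally show "\<eta> * s < 2" .
    qed
    then have "norm \<mu> < 1" unfolding sl(1) norm_of_real by linarith
    with \<mu>(1) show ?thesis by simp
  qed
  then show ?thesis using lam0 by (intro exI[of _ "1 / lam 0"]) simp
qed

end
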